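(* Let $\varepsilon\ge0$ be a fixed tolerance and assume that $s_n^\top r_0=\eta_n\ne0$. There exists an iterate $\ell_0$ of deflated CG such that $|\lambda_n-v_{\ell_0}^{(\ell_0)}|\le\varepsilon$, where $v_{\ell_0}^{(\ell_0)}$ is the smallest root of the polynomial $$\{p_{\ell_0}^{D}\}=\arg\min_{p\in\mathbb{P}_{\ell_0}(0)}\sum_{i\in\bar\pi_k^a}\frac{\eta_i^2}{\lambda_i}p(\lambda_i)^2 .$$ Let $x_\ell^{D}=\sum_{i\in\pi_k^a}\frac1{\lambda_i}s_is_i^\top b+Pz_\ell$ be the deflated CG iterates, and let $F_{\lambda_n}=I_n+\sum_{i\in\pi_k^a}\big(\frac{\lambda_n}{\lambda_i}-1\big)s_is_i^\top$. Then the following bounds hold: $$\|x^\ast-\hat x_\ell(F_{\lambda_n})\|_A^2\le\|x^\ast-x_\ell^{D}\|_A^2+\sum_{i\in\pi_k^a}\frac{\eta_i^2}{\lambda_i}\quad\text{if }\ell<\ell_0,$$ $$\|x^\ast-\hat x_\ell(F_{\lambda_n})\|_A^2\le\|x^\ast-x_\ell^{D}\|_A^2+\frac{\varepsilon^2}{\lambda_n^2}\sum_{i\in\pi_k^a}\frac{\eta_i^2}{\lambda_i}\quad\text{if }\ell\ge\ell_0.$$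
   Context: $A\in\mathbb{R}^{n\times n}$ is symmetric positive definite with spectral decomposition $A=S\Lambda S^\top$, $\Lambda=\mathrm{diag}(\lambda_1,\dots,\lambda_n)$, $\lambda_1\ge\dots\ge\lambda_n>0$, $S=[s_1\ \cdots\ s_n]$ orthogonal. $b\in\mathbb{R}^n$, $x^\ast=A^{-1}b$, $x_0\in\mathbb{R}^n$ is an initial guess, $r_0=b-Ax_0$, $\eta_i=s_i^\top r_0$. $\|x\|_A=\sqrt{x^\top A x}$. $\mathbb{P}_\ell(0)$ is the set of real polynomials of degree at most $\ell$ with value $1$ at $0$. $k$ is an integer with $1<k<n$. A bar over a subset of $\{1,\dots,n\}$ denotes its complement. Exact arithmetic is assumed. Selected index set: among the subsets $\pi_k\subset\{1,\dots,n\}$ of cardinality $k$, $\pi_k^a$ is a minimizer of $\kappa_{\bar\pi_k}=\max_{i\in\bar\pi_k}\lambda_i/\min_{i\in\bar\pi_k}\lambda_i$, taken of the form $\bar\pi_k^a=\{j_0,j_0+1,\dots,n-k+j_0-1\}$ with $j_0\in\arg\min_{1\le j\le k+1}\lambda_j/\lambda_{n-k+j-1}$. Thus $\pi_k^a$ consists of the indices of the $k$ largest eigenvalues ($j_0=k+1$), of the $k$ smallest ($j_0=1$), or of a mixture of largest and smallest ones ($1<j_0<k+1$). Feasible preconditioner: $F=I_n+SDS^\top$ with $D=\mathrm{diag}(d_1,\dots,d_n)$ real, $I_n+D$ positive definite and $\mathrm{rank}(D)\le k$. $\mathbf{PCG}(F)$ is the preconditioned conjugate gradient method for $Ax=b$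 with preconditioner $F$: $\hat x_0=x_0$, $\hat r_0=b-A\hat x_0$, $z_0=F\hat r_0$, $\hat\rho_0=\hat r_0^\top z_0$, $\hat p_0=z_0$, and for $\ell=0,1,\dots$: $\hat q_\ell=A\hat p_\ell$, $\hat\alpha_\ell=\hat\rho_\ell/(\hat q_\ell^\top\hat p_\ell)$, $\hat x_{\ell+1}=\hat x_\ell+\hat\alpha_\ell\hat p_\ell$, $\hat r_{\ell+1}=\hat r_\ell-\hat\alpha_\ell\hat q_\ell$, $z_{\ell+1}=F\hat r_{\ell+1}$, $\hat\rho_{\ell+1}=\hat r_{\ell+1}^\top z_{\ell+1}$, $\hat\beta_{\ell+1}=\hat\rho_{\ell+1}/\hat\rho_\ell$, $\hat p_{\ell+1}=z_{\ell+1}+\hat\beta_{\ell+1}\hat p_\ell$. $\hat x_\ell(F)$ denotes its $\ell$-th iterate. The same recurrences with $F=I_n$ define CG, also for a consistent system with symmetric positive semidefinite matrix. Deflated CG: $P=I_n-\sum_{i\in\pi_k^a}s_is_i^\top$, and $z_\ell$ in the definition of $x_\ell^{D}$ is the $\ell$-th iterate of CG applied to the consistent system $PAz=Pb$ starting from $z_0=x_0$ (not the $z_\ell$ of the PCG recurrences). Standing assumption: $\ell\ge1$ and, for $F$ feasible, $\mathbf{PCG}(F)$ has not yet reached the solution at iteration $\ell$.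
   Formalization: The existence of ℓ_0 is claimed only when n lies in the complement of π_k^a (the k largest eigenvalues are selected), since it can fail otherwise, e.g. λ=(4,3,3,1), k=2, ε=0; both bounds are proved for every choice of π_k^a and every ℓ_0 with the stated closeness property. *)

theory Defs
  imports "HOL-Analysis.Analysis" "HOL-Computational_Algebra.Polynomial"
begin

definition pos_def :: "real^'n^'n \<Rightarrow> bool" where
  "pos_def A \<longleftrightarrow> transpose A = A \<and> (\<forall>x. x \<noteq> 0 \<longrightarrow> 0 < x \<bullet> (A *v x))"

definition outer :: "real^'n \<Rightarrow> real^'n^'n" where
  "outer v = (\<chi> i j. v $ i * v $ j)"

text \<open>
  With n the dimension, the columns s 1, ..., s n of S and the diagonal entries
  lam 1, ..., lam n of the diagonal factor are indexed by the numbers 1, ..., n; values outside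
  this range are irrelevant. The first two conditions are the orthogonality of S and the
  factorization of A, written column by column.
\<close>

definition spectral_decomposition ::
    "real^'n^'n \<Rightarrow> (nat \<Rightarrow> real^'n) \<Rightarrow> (nat \<Rightarrow> real) \<Rightarrow> bool" where
  "spectral_decomposition A s lam \<longleftrightarrow>
     (\<forall>i\<in>{1..CARD('n)}. \<forall>j\<in>{1..CARD('n)}. s i \<bullet> s j = (if i = j then 1 else 0)) \<and>
     A = (\<Sum>i=1..CARD('n). lam i *\<^sub>R outer (s i)) \<and>
     (\<forall>i\<in>{1..CARD('n)}. \<forall>j\<in>{1..CARD('n)}. i \<le> j \<longrightarrow> lam j \<le> lam i) \<and>
     0 < lam CARD('n)"

definition energy_norm :: "real^'n^'n \<Rightarrow> real^'n \<Rightarrow> real" where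
  "energy_norm A x = sqrt (x \<bullet> (A *v x))"

definition cond_ratio :: "(nat \<Rightarrow> real) \<Rightarrow> nat set \<Rightarrow> real" where
  "cond_ratio lam I = Max (lam ` I) / Min (lam ` I)"

text \<open>
  The argmin over j need not be a singleton; every choice of j0 in it is admitted.
\<close>

definition selected_index_set :: "(nat \<Rightarrow> real) \<Rightarrow> nat \<Rightarrow> nat \<Rightarrow> nat set \<Rightarrow> bool" where
  "selected_index_set lam n k I \<longleftrightarrow>
     is_arg_min (\<lambda>J. cond_ratio lam ({1..n} - J)) (\<lambda>J. J \<subseteq> {1..n} \<and> card J = k) I \<and>
     (\<exists>j0. is_arg_min (\<lambda>j. lam j / lam (n - k + j - 1)) (\<lambda>j. 1 \<le> j \<and> j \<le> k + 1) j0 \<and>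
           {1..n} - I = {j0..n - k + j0 - 1})"

text \<open>
  The state after l steps of preconditioned CG is the triple of iterate, recursive residual and
  search direction. Since division by zero yields zero, the iterates stay constant
  once the residual vanishes.
\<close>

primrec pcg_state ::
    "real^'n^'n \<Rightarrow> real^'n^'n \<Rightarrow> real^'n \<Rightarrow> real^'n \<Rightarrow> nat \<Rightarrow> (real^'n) \<times> (real^'n) \<times> (real^'n)"
  where
  "pcg_state F A b x0 0 = (x0, b - A *v x0, F *v (b - A *v x0))"
| "pcg_state F A b x0 (Suc l) =
     (let (x, r, p) = pcg_state F A b x0 l;
          rho = r \<bullet> (F *v r);
          q = A *v p;
          alpha = rho / (q \<bullet> p);
          x' = x + alpha *\<^sub>R p;
          r' = r - alpha *\<^sub>R q;
          z' = F *v r';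
          rho' = r' \<bullet> z';
          beta = rho' / rho
      in (x', r', z' + beta *\<^sub>R p))"

definition pcg :: "real^'n^'n \<Rightarrow> real^'n^'n \<Rightarrow> real^'n \<Rightarrow> real^'n \<Rightarrow> nat \<Rightarrow> real^'n" where
  "pcg F A b x0 l = fst (pcg_state F A b x0 l)"

definition cg :: "real^'n^'n \<Rightarrow> real^'n \<Rightarrow> real^'n \<Rightarrow> nat \<Rightarrow> real^'n" where
  "cg A b x0 l = pcg (mat 1) A b x0 l"

definition defl_proj :: "(nat \<Rightarrow> real^'n) \<Rightarrow> nat set \<Rightarrow> real^'n^'n" where
  "defl_proj s I = mat 1 - (\<Sum>i\<in>I. outer (s i))"

definition defl_inner ::
    "real^'n^'n \<Rightarrow> real^'n \<Rightarrow> real^'n \<Rightarrow> (nat \<Rightarrow> real^'n) \<Rightarrow> nat set \<Rightarrow> nat \<Rightarrow> real^'n" where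
  "defl_inner A b x0 s I l = cg (defl_proj s I ** A) (defl_proj s I *v b) x0 l"

definition defl_cg ::
    "real^'n^'n \<Rightarrow> real^'n \<Rightarrow> real^'n \<Rightarrow> (nat \<Rightarrow> real^'n) \<Rightarrow> (nat \<Rightarrow> real) \<Rightarrow> nat set \<Rightarrow> nat \<Rightarrow> real^'n"
  where
  "defl_cg A b x0 s lam I l =
     (\<Sum>i\<in>I. (1 / lam i) *\<^sub>R (outer (s i) *v b)) + defl_proj s I *v defl_inner A b x0 s I l"

text \<open>
  Iterate l is actually computed by deflated CG if none of the earlier inner iterates solves
  the projected system.
\<close>

definition defl_cg_reaches ::
    "real^'n^'n \<Rightarrow> real^'n \<Rightarrow> real^'n \<Rightarrow> (nat \<Rightarrow> real^'n) \<Rightarrow> nat set \<Rightarrow> nat \<Rightarrow> bool" where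
  "defl_cg_reaches A b x0 s I l \<longleftrightarrow>
     (\<forall>j<l. (defl_proj s I ** A) *v defl_inner A b x0 s I j \<noteq> defl_proj s I *v b)"

definition defl_precond ::
    "(nat \<Rightarrow> real^'n) \<Rightarrow> (nat \<Rightarrow> real) \<Rightarrow> nat set \<Rightarrow> real \<Rightarrow> real^'n^'n" where
  "defl_precond s lam I \<theta> = mat 1 + (\<Sum>i\<in>I. (\<theta> / lam i - 1) *\<^sub>R outer (s i))"

definition polys_one :: "nat \<Rightarrow> real poly set" where
  "polys_one l = {p. degree p \<le> l \<and> poly p 0 = 1}"

definition defl_argmin ::
    "(nat \<Rightarrow> real) \<Rightarrow> (nat \<Rightarrow> real) \<Rightarrow> nat set \<Rightarrow> nat \<Rightarrow> real poly set" where
  "defl_argmin lam eta K l =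
     {p. is_arg_min (\<lambda>p. \<Sum>i\<in>K. (eta i)\<^sup>2 / lam i * (poly p (lam i))\<^sup>2) (\<lambda>p. p \<in> polys_one l) p}"

definition is_smallest_root :: "real poly \<Rightarrow> real \<Rightarrow> bool" where
  "is_smallest_root p v \<longleftrightarrow> poly p v = 0 \<and> (\<forall>w. poly p w = 0 \<longrightarrow> v \<le> w)"

end

theory Submission
  imports Defs "HOL-Computational_Algebra.Fundamental_Theorem_Algebra"
begin

text \<open>
  In the eigenbasis of \<open>A\<close> both methods become polynomial minimization. After
  \<open>l\<close> steps the squared error of deflated CG is the minimum of
  \<open>\<Sum>i\<in>K. (eta i)\<^sup>2 / lam i * (q (lam i))\<^sup>2\<close> over the polynomials
  \<open>q\<close> of degree at most \<open>l\<close> with value 1 at 0. The preconditioner \<open>F\<close>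
  leaves the eigenvalues with index in \<open>K\<close> where they are and moves all others to
  \<open>lam n\<close>, so that the squared error of the preconditioned method is the minimum of the
  same sum plus \<open>(q (lam n))\<^sup>2 * (\<Sum>i\<in>I. (eta i)\<^sup>2 / lam i)\<close>.
  Inserting the deflated residual polynomial \<open>q\<close> into the second problem reduces the
  bounds to estimates of \<open>q (lam n)\<close>.

  For these only the position of \<open>lam n\<close> matters: it lies to the left of all eigenvalues
  with index in \<open>K\<close>. All complex roots of a residual polynomial are real and not smaller
  than \<open>lam n\<close> (\<open>roots_ge_res_poly\<close>). The polynomial is therefore a product of
  factors \<open>1 - x / v\<close> that lie in \<open>[0, 1]\<close> at \<open>x = lam n\<close>, which
  gives \<open>0 \<le> q (lam n) \<le> 1\<close> and the bound valid for every \<open>l\<close>. At step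
  \<open>l0\<close> the smallest root \<open>v\<close> contributes the factor
  \<open>1 - lam n / v \<le> \<epsilon> / lam n\<close>. The values at \<open>lam n\<close> do not increase from
  one step to the next (\<open>res_poly_decreasing\<close>), because each step subtracts a nonnegative
  multiple of a search direction polynomial that is itself nonnegative there; so the estimate
  persists for \<open>l \<ge> l0\<close>. This replaces the usual argument by interlacing of the
  roots of consecutive orthogonal polynomials, and it continues to work after deflated CG has
  terminated, when the minimizer is no longer unique.

  If \<open>n \<in> K\<close>, a suitable \<open>l0\<close> is the step at which deflated CG terminates. Its residual polynomial
  then vanishes at every eigenvalue that is present in the initial residual, hence at
  \<open>lam n\<close>, and it is the unique minimizer of its degree
  (\<open>minimizer_at_termination_unique\<close>).
\<close>

section \<open>Real polynomials with all roots to the right of a point\<close>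

definition roots_ge :: "real poly \<Rightarrow> real \<Rightarrow> bool" where
  "roots_ge p x \<longleftrightarrow>
     (\<forall>z::complex. poly (map_poly of_real p) z = 0 \<longrightarrow> z \<in> \<real> \<and> x \<le> Re z)"

lemma poly_of_real_complex:
  "poly (map_poly of_real p) (of_real x :: complex) = of_real (poly p x)"
  by (induction p) (auto simp: map_poly_pCons)

lemma map_poly_of_real_mult:
  "map_poly of_real (p * q) = (map_poly of_real p * map_poly of_real q :: complex poly)"
  by (intro poly_eqI) (simp add: coeff_map_poly coeff_mult)

lemma map_poly_of_real_add:
  "map_poly of_real (p + q) = (map_poly of_real p + map_poly of_real q :: complex poly)"
  by (intro poly_eqI) (simp add: coeff_map_poly)

lemma roots_ge_real_root: "roots_ge p x \<Longrightarrow> poly p v = 0 \<Longrightarrow> x \<le> v"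
  unfolding roots_ge_def using poly_of_real_complex[of p v] by fastforce

lemma split_real_root:
  fixes p :: "real poly"
  assumes "poly p 0 = 1" "poly p v = 0"
  obtains g where "p = [:1, -1/v:] * g" "poly g 0 = 1" "degree p = Suc (degree g)" "v \<noteq> 0"
proof -
  have v: "v \<noteq> 0" using assms by auto
  obtain h where h: "p = [:-v, 1:] * h"
    using assms(2) by (auto simp: poly_eq_0_iff_dvd dvd_def)
  have "[:-v, 1:] = smult (-v) [:1, -1/v:]" using v by simp
  then have eq: "p = [:1, -1/v:] * smult (-v) h"
    using h by (metis mult_smult_left mult_smult_right)
  have g0: "poly (smult (-v) h) 0 = 1"
    using assms(1) unfolding eq poly_mult by simp
  then have "smult (-v) h \<noteq> 0" by auto
  then have "degree p = degree [:1, -1/v:] + degree (smult (-v) h)"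
    unfolding eq by (intro degree_mult_eq) auto
  then show thesis using that[OF eq g0] v by simp
qed

text \<open>
  A non-real root comes with its conjugate, and the two linear factors combine into a real
  quadratic without real zeros. Real coefficients force the remainder of the division by this
  quadratic to vanish, since a real linear polynomial has no non-real root.
\<close>

lemma split_nonreal_root:
  fixes p :: "real poly" and z :: complex
  assumes p0: "poly p 0 = 1" and z: "poly (map_poly of_real p) z = 0" "z \<notin> \<real>"
  obtains q g where "p = q * g" "\<And>x. 0 < poly q x" "poly q 0 = 1" "poly g 0 = 1"
    "degree p = degree g + 2"
proof -
  define c where "c = (cmod z)\<^sup>2"
  have imz: "Im z \<noteq> 0" using z(2) by (simp add: complex_is_Real_iff)
  have c: "c = (Re z)\<^sup>2 + (Im z)\<^sup>2" by (simp add: c_def cmod_power2)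
  have cpos: "c > 0" using imz by (simp add: c add_nonneg_pos)
  define q :: "real poly" where "q = [:1, -2 * Re z / c, 1 / c:]"
  have degq: "degree q = 2" using cpos by (simp add: q_def)
  have qz: "poly (map_poly of_real q) z = 0"
    using cpos unfolding q_def
    by (simp add: map_poly_pCons complex_eq_iff field_simps power2_eq_square)
       (simp add: c power2_eq_square algebra_simps)
  have qpos: "0 < poly q x" for x
  proof -
    have "c * poly q x = (x - Re z)\<^sup>2 + (Im z)\<^sup>2"
      using cpos by (simp add: q_def field_simps power2_eq_square)
        (simp add: c power2_eq_square algebra_simps)
    moreover have "\<dots> > 0" using imz by (simp add: add_nonneg_pos)
    ultimately have "0 < c * poly q x" by simp
    then show ?thesis using cpos by (rule zero_less_mult_pos)
  qed
  have "degree (p mod q) < 2 \<or> p mod q = 0"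
    using degree_mod_less[of q p] degq by fastforce
  then obtain a b where ab: "p mod q = [:a, b:]"
  proof
    assume "degree (p mod q) < 2"
    then have "degree (p mod q) \<le> 1" by simp
    then show ?thesis using degree1_coeffs that by (metis degree_eq_zeroE le_Suc_eq le_zero_eq
        One_nat_def pCons_0_0)
  next
    assume "p mod q = 0" then show ?thesis using that[of 0 0] by simp
  qed
  have "p = q * (p div q) + [:a, b:]" using ab by (metis mult_div_mod_eq)
  then have "map_poly of_real p
      = map_poly of_real q * map_poly of_real (p div q) + (map_poly of_real [:a, b:] :: complex poly)"
    by (metis map_poly_of_real_mult map_poly_of_real_add)
  then have "poly (map_poly of_real [:a, b:]) z = 0" using z(1) qz by simp
  then have "of_real a + z * of_real b = 0" by (simp add: map_poly_pCons)
  then have "b * Im z = 0" "a + b * Re z = 0"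
    by (simp_all add: complex_eq_iff mult.commute)
  then have "[:a, b:] = 0" using imz by simp
  then have pq: "p = q * (p div q)" using ab by (metis dvd_mult_div_cancel mod_eq_0_iff_dvd)
  have q0: "poly q 0 = 1" by (simp add: q_def)
  have g0: "poly (p div q) 0 = 1" using p0 pq q0 by (metis mult_1 poly_mult)
  have "q \<noteq> 0" "p div q \<noteq> 0" using q0 g0 by auto
  then have "degree p = degree (p div q) + 2"
    using pq degq degree_mult_eq by (metis add.commute)
  then show thesis using that[OF pq qpos q0 g0] by simp
qed

lemma roots_ge_factor: "roots_ge (q * g) x \<Longrightarrow> roots_ge g x"
  by (auto simp: roots_ge_def map_poly_of_real_mult)

text \<open>
  Such a polynomial is a product of factors \<open>1 - x / v\<close> with roots \<open>v \<ge> x\<close>, each of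
  which lies in \<open>[0, 1]\<close>.
\<close>

lemma roots_ge_bounds:
  assumes "roots_ge p x" "poly p 0 = 1" "0 < x"
  shows "0 \<le> poly p x \<and> poly p x \<le> 1"
  using assms
proof (induction "degree p" arbitrary: p rule: less_induct)
  case less
  show ?case
  proof (cases "degree p = 0")
    case True
    then show ?thesis using less.prems(2) by (auto elim!: degree_eq_zeroE)
  next
    case False
    then have "degree (map_poly of_real p :: complex poly) \<noteq> 0"
      by (simp add: degree_map_poly)
    then have "\<exists>z::complex. poly (map_poly of_real p) z = 0"
      by (intro fundamental_theorem_of_algebra) (simp add: constant_degree)
    then obtain z :: complex where z: "poly (map_poly of_real p) z = 0" by blast
    then have "z \<in> \<real>" and zx: "x \<le> Re z"
      using less.prems(1) by (auto simp: roots_ge_def)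
    then have "poly p (Re z) = 0"
      using z poly_of_real_complex[of p "Re z"] by (simp add: complex_is_Real_iff complex_eq_iff)
    then obtain g where g: "p = [:1, -1/Re z:] * g" "poly g 0 = 1" "degree p = Suc (degree g)"
      using split_real_root less.prems(2) by metis
    have "roots_ge g x" using less.prems(1) unfolding g(1) by (rule roots_ge_factor)
    then have IH: "0 \<le> poly g x" "poly g x \<le> 1" using less.hyps[of g] g less.prems by auto
    have "poly p x = (1 - x / Re z) * poly g x" by (simp add: g(1) algebra_simps)
    moreover have "0 \<le> 1 - x / Re z" "1 - x / Re z \<le> 1" using zx less.prems(3) by auto
    ultimately show ?thesis using IH by (simp add: mult_le_one)
  qed
qed

lemma roots_ge_root_bound:
  assumes "roots_ge p x" "poly p 0 = 1" "0 < x" "poly p v = 0"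
  shows "poly p x \<le> 1 - x / v"
proof -
  obtain g where g: "p = [:1, -1/v:] * g" "poly g 0 = 1"
    using split_real_root assms by metis
  have "poly g x \<le> 1"
    using roots_ge_bounds roots_ge_factor assms g by metis
  moreover have "0 \<le> 1 - x / v"
    using roots_ge_real_root[OF assms(1,4)] assms(3) by simp
  ultimately have "(1 - x / v) * poly g x \<le> (1 - x / v) * 1" by (rule mult_left_mono)
  then show ?thesis by (simp add: g(1) algebra_simps)
qed

section \<open>Conjugate gradients as polynomials over a discrete measure\<close>

text \<open>
  In an eigenbasis the conjugate gradient method only sees the eigenvalues \<open>\<mu> i\<close> and the
  squared components \<open>m i\<close> of the initial residual, weighted by the eigenvalues of
  the preconditioner.
\<close>

locale discrete_measure =
  fixes N :: "'i set" and m \<mu> :: "'i \<Rightarrow> real"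
  assumes finite_N: "finite N"
    and m_nonneg: "i \<in> N \<Longrightarrow> 0 \<le> m i"
    and mu_pos: "i \<in> N \<Longrightarrow> 0 < \<mu> i"
begin

definition ip :: "real poly \<Rightarrow> real poly \<Rightarrow> real" where
  "ip f g = (\<Sum>i\<in>N. m i * poly f (\<mu> i) * poly g (\<mu> i))"

text \<open>The squared energy norm of the error whose residual is given by the polynomial.\<close>

definition energy :: "real poly \<Rightarrow> real" where
  "energy f = (\<Sum>i\<in>N. m i / \<mu> i * (poly f (\<mu> i))\<^sup>2)"

definition null :: "real poly \<Rightarrow> bool" where
  "null f \<longleftrightarrow> (\<forall>i\<in>N. m i * poly f (\<mu> i) = 0)"

lemma ip_commute: "ip f g = ip g f"
  by (simp add: ip_def mult_ac)

lemma ip_add_left: "ip (f + g) h = ip f h + ip g h"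
  by (simp add: ip_def sum.distrib algebra_simps)

lemma ip_diff_left: "ip (f - g) h = ip f h - ip g h"
  by (simp add: ip_def sum_subtractf algebra_simps)

lemma ip_smult_left: "ip (smult c f) h = c * ip f h"
  by (simp add: ip_def sum_distrib_left mult_ac)

lemma ip_add_right: "ip h (f + g) = ip h f + ip h g"
  by (metis ip_add_left ip_commute)

lemma ip_diff_right: "ip h (f - g) = ip h f - ip h g"
  by (metis ip_diff_left ip_commute)

lemma ip_smult_right: "ip h (smult c f) = c * ip h f"
  by (metis ip_smult_left ip_commute)

lemmas ip_linear = ip_add_left ip_diff_left ip_smult_left ip_add_right ip_diff_right ip_smult_right

lemma ip_shift: "ip (pCons 0 f) g = ip f (pCons 0 g)"
  by (simp add: ip_def mult_ac)

lemma ip_null: "null f \<Longrightarrow> ip f g = 0"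
  by (auto simp: ip_def null_def intro!: sum.neutral)

lemma null_smult: "null f \<Longrightarrow> null (smult c f)"
  by (auto simp: null_def)

lemma null_diff: "null f \<Longrightarrow> null g \<Longrightarrow> null (f - g)"
  unfolding null_def by (metis poly_diff mult_eq_0_iff diff_zero)

lemma null_pCons_0: "null (pCons 0 f) \<longleftrightarrow> null f"
  using mu_pos by (fastforce simp: null_def)

lemma null_iff_mult_zero:
  assumes "i \<in> N" "0 < c"
  shows "m i * (c * (poly f (\<mu> i))\<^sup>2) = 0 \<longleftrightarrow> m i * poly f (\<mu> i) = 0"
  using assms by auto

lemma sum_zero_iff_null:
  assumes "\<And>i. i \<in> N \<Longrightarrow> 0 < c i"
  shows "(\<Sum>i\<in>N. m i * (c i * (poly f (\<mu> i))\<^sup>2)) = 0 \<longleftrightarrow> null f"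
proof -
  have "0 \<le> m i * (c i * (poly f (\<mu> i))\<^sup>2)" if "i \<in> N" for i
    using assms[OF that] m_nonneg[OF that] by simp
  then have "(\<Sum>i\<in>N. m i * (c i * (poly f (\<mu> i))\<^sup>2)) = 0 \<longleftrightarrow>
      (\<forall>i\<in>N. m i * (c i * (poly f (\<mu> i))\<^sup>2) = 0)"
    using finite_N by (rule sum_nonneg_eq_0_iff[rotated])
  then show ?thesis
    unfolding null_def using assms by (simp only: null_iff_mult_zero cong: ball_cong)
qed

lemma ip_self_zero: "ip f f = 0 \<longleftrightarrow> null f"
  using sum_zero_iff_null[of "\<lambda>_. 1" f] by (simp add: ip_def power2_eq_square mult.assoc)

lemma ip_shift_zero: "ip (pCons 0 f) f = 0 \<longleftrightarrow> null f"
  using sum_zero_iff_null[of \<mu> f] mu_pos by (simp add: ip_def power2_eq_square mult.assoc)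

lemma energy_zero: "energy f = 0 \<longleftrightarrow> null f"
  using sum_zero_iff_null[of "\<lambda>i. 1 / \<mu> i" f] mu_pos by (simp add: energy_def)

lemma energy_nonneg: "0 \<le> energy f"
  unfolding energy_def using m_nonneg mu_pos by (intro sum_nonneg) (simp add: less_imp_le)

lemma ip_self_nonneg: "0 \<le> ip f f"
  unfolding ip_def using m_nonneg by (intro sum_nonneg) (simp add: mult.assoc)

lemma ip_shift_nonneg: "0 \<le> ip (pCons 0 f) f"
proof -
  have "0 \<le> m i * (\<mu> i * poly f (\<mu> i)) * poly f (\<mu> i)" if "i \<in> N" for i
  proof -
    have "0 \<le> m i * \<mu> i * (poly f (\<mu> i))\<^sup>2"
      using m_nonneg[OF that] mu_pos[OF that] by simp
    then show ?thesis by (simp add: power2_eq_square mult_ac)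
  qed
  then show ?thesis by (auto simp: ip_def intro: sum_nonneg)
qed

text \<open>
  The polynomials that turn the initial residual into the residual and the search direction;
  the coefficients are those of the method, with a zero denominator giving zero.
\<close>

primrec cg_polys :: "nat \<Rightarrow> real poly \<times> real poly" where
  "cg_polys 0 = (1, 1)"
| "cg_polys (Suc l) =
     (let (r, d) = cg_polys l;
          r' = r - smult (ip r r / ip (pCons 0 d) d) (pCons 0 d)
      in (r', r' + smult (ip r' r' / ip r r) d))"

definition res_poly :: "nat \<Rightarrow> real poly" where "res_poly l = fst (cg_polys l)"
definition dir_poly :: "nat \<Rightarrow> real poly" where "dir_poly l = snd (cg_polys l)"

lemma cg_polys_0 [simp]: "res_poly 0 = 1" "dir_poly 0 = 1"
  by (simp_all add: res_poly_def dir_poly_def)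

lemma res_poly_Suc:
  "res_poly (Suc l) = res_poly l - smult (ip (res_poly l) (res_poly l) /
     ip (pCons 0 (dir_poly l)) (dir_poly l)) (pCons 0 (dir_poly l))"
  by (simp add: res_poly_def dir_poly_def case_prod_beta Let_def)

lemma dir_poly_Suc:
  "dir_poly (Suc l) = res_poly (Suc l) + smult (ip (res_poly (Suc l)) (res_poly (Suc l)) /
     ip (res_poly l) (res_poly l)) (dir_poly l)"
  by (simp add: res_poly_def dir_poly_def case_prod_beta Let_def)

lemma degree_cg_polys: "degree (res_poly l) \<le> l \<and> degree (dir_poly l) \<le> l"
proof (induction l)
  case (Suc l)
  have "degree (smult c (pCons 0 (dir_poly l))) \<le> Suc l" for c
    using Suc by (auto intro: order_trans[OF degree_smult_le] simp: degree_pCons_eq_if)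
  then have r: "degree (res_poly (Suc l)) \<le> Suc l"
    unfolding res_poly_Suc using Suc by (intro degree_diff_le) auto
  have "degree (smult c (dir_poly l)) \<le> Suc l" for c
    using Suc by (auto intro: order_trans[OF degree_smult_le])
  then have "degree (dir_poly (Suc l)) \<le> Suc l"
    unfolding dir_poly_Suc by (intro degree_add_le r)
  then show ?case using r by blast
qed simp

lemma res_poly_at_0: "poly (res_poly l) 0 = 1"
  by (induction l) (simp_all add: res_poly_Suc)

lemma res_poly_stops: "null (res_poly l) \<Longrightarrow> res_poly (Suc l) = res_poly l"
  by (simp add: res_poly_Suc ip_null)

text \<open>
  The classical orthogonality relations. They survive a vanishing residual, because all later
  residuals and directions then vanish at the nodes as well; before that point the direction of
  step \<open>l\<close> has degree exactly \<open>l\<close>, so that together with the lower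
  degrees it spans everything of degree \<open>l\<close>. "Degree below \<open>l\<close>" is
  expressed by coefficients in order to cover the zero polynomial when \<open>l = 0\<close>.
\<close>

lemma cg_orthogonality:
  "(\<forall>h. (\<forall>j\<ge>l. coeff h j = 0) \<longrightarrow>
      ip (res_poly l) h = 0 \<and> ip (pCons 0 (dir_poly l)) h = 0) \<and>
   ip (res_poly l) (dir_poly l) = ip (res_poly l) (res_poly l) \<and>
   (null (res_poly l) \<longrightarrow> null (dir_poly l)) \<and>
   (\<not> null (res_poly l) \<longrightarrow> coeff (dir_poly l) l \<noteq> 0)"
proof (induction l)
  case 0
  have "h = 0" if "\<forall>j. coeff h j = 0" for h :: "real poly"
    using that by (intro poly_eqI) simp
  then show ?case by (fastforce simp: ip_def)
next
  case (Suc l)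
  define r d r' d' where rd: "r = res_poly l" "d = dir_poly l"
    "r' = res_poly (Suc l)" "d' = dir_poly (Suc l)"
  note IH = Suc[folded rd]
  show ?case
  proof (cases "null r")
    case True
    then have "r' = r" "d' = r"
      using res_poly_stops[of l] by (simp_all add: rd dir_poly_Suc ip_null)
    moreover have "null (pCons 0 r)" using True by (simp add: null_pCons_0)
    ultimately show ?thesis
      using True unfolding rd(3,4)[symmetric] by (simp add: ip_null)
  next
    case False
    define \<rho> \<kappa> \<alpha> \<beta> where scal: "\<rho> = ip r r" "\<kappa> = ip (pCons 0 d) d"
      "\<alpha> = \<rho> / \<kappa>" "\<beta> = ip r' r' / \<rho>"
    have rho: "\<rho> \<noteq> 0" using False by (simp add: scal ip_self_zero)
    have kappa: "\<kappa> \<noteq> 0"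
    proof
      assume "\<kappa> = 0"
      then have "null d" by (simp add: scal ip_shift_zero)
      then have "ip d r = 0" by (rule ip_null)
      then show False using IH rho by (simp add: ip_commute scal)
    qed
    have alpha: "\<alpha> \<noteq> 0" using rho kappa by (simp add: scal)
    have r': "r' = r - smult \<alpha> (pCons 0 d)" by (simp add: rd scal res_poly_Suc)
    have d': "d' = r' + smult \<beta> d" by (simp add: rd scal dir_poly_Suc)
    have lead: "coeff d l \<noteq> 0" using IH False by simp
    have deg: "coeff r j = 0" "coeff d j = 0" if "l < j" for j
      using degree_cg_polys[of l] that by (auto simp: rd intro!: coeff_eq_0)
    have split: "\<exists>c h'. h = smult c d + h' \<and> (\<forall>j\<ge>l. coeff h' j = 0)"
      if h: "\<forall>j\<ge>Suc l. coeff h j = 0" for h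
    proof (intro exI conjI)
      show "h = smult (coeff h l / coeff d l) d + (h - smult (coeff h l / coeff d l) d)" by simp
      have "coeff (h - smult (coeff h l / coeff d l) d) j = 0" if "j \<ge> l" for j
        using that h lead deg by (cases "j = l") auto
      then show "\<forall>j\<ge>l. coeff (h - smult (coeff h l / coeff d l) d) j = 0" by blast
    qed
    have r'd: "ip r' d = 0"
      using IH kappa by (simp add: r' ip_linear scal del: smult_pCons)
    have r'_orth: "ip r' h = 0" if h: "\<forall>j\<ge>Suc l. coeff h j = 0" for h
    proof -
      obtain c h' where h': "h = smult c d + h'" "\<forall>j\<ge>l. coeff h' j = 0"
        using split[OF h] by blast
      have "ip r h' = 0" "ip (pCons 0 d) h' = 0" using IH h' by auto
      then have "ip r' h' = 0" by (simp add: r' ip_linear del: smult_pCons)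
      then show ?thesis using r'd by (simp add: h' ip_linear)
    qed
    have r'r: "ip r' r = 0" using deg by (intro r'_orth) auto
    have d'd: "ip (pCons 0 d') d = 0"
    proof -
      \<comment> \<open>the shifted direction is the difference of two consecutive residuals\<close>
      have "smult \<alpha> (pCons 0 d) = r - r'" by (simp add: r')
      then have "ip r' (smult \<alpha> (pCons 0 d)) = ip r' (r - r')" by (rule arg_cong)
      then have "\<alpha> * ip r' (pCons 0 d) = - ip r' r'"
        unfolding ip_smult_right ip_diff_right r'r by simp
      moreover have "ip (pCons 0 d') d = ip r' (pCons 0 d) + \<beta> * \<kappa>"
        by (simp add: ip_shift d' ip_linear scal)
      moreover have "\<alpha> * (\<beta> * \<kappa>) = ip r' r'" using rho kappa by (simp add: scal)
      ultimately have "\<alpha> * ip (pCons 0 d') d = 0" by (simp add: distrib_left)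
      then show ?thesis using alpha by simp
    qed
    have d'_orth: "ip (pCons 0 d') h = 0" if h: "\<forall>j\<ge>Suc l. coeff h j = 0" for h
    proof -
      obtain c h' where h': "h = smult c d + h'" "\<forall>j\<ge>l. coeff h' j = 0"
        using split[OF h] by blast
      have "ip r' (pCons 0 h') = 0"
        using h'(2) by (intro r'_orth) (auto simp: coeff_pCons split: nat.split)
      moreover have "ip (pCons 0 d) h' = 0" using IH h'(2) by blast
      then have "ip d (pCons 0 h') = 0" by (simp only: ip_shift)
      ultimately have "ip (pCons 0 d') h' = 0" by (simp add: ip_shift d' ip_linear)
      then show ?thesis using d'd by (simp add: h' ip_linear)
    qed
    have "ip r' d' = ip r' r'" using r'd by (simp add: d' ip_linear)
    moreover have "null d'" if "null r'"
    proof -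
      have "\<beta> = 0" using that by (simp add: scal ip_null)
      then show ?thesis using that d' by simp
    qed
    moreover have "coeff d' (Suc l) \<noteq> 0"
      using deg lead alpha by (simp add: d' r')
    ultimately show ?thesis
      unfolding rd(3,4)[symmetric] using r'_orth d'_orth by simp
  qed
qed

lemma res_poly_orthogonal: "\<forall>j\<ge>l. coeff h j = 0 \<Longrightarrow> ip (res_poly l) h = 0"
  using cg_orthogonality by blast

text \<open>
  Two polynomials with value 1 at 0 differ by a multiple of the variable, which
  cancels the weight \<open>1 / \<mu>\<close> of the energy: the mixed term of the square becomes an
  inner product of the residual with a polynomial of lower degree.
\<close>

lemma res_poly_optimal:
  assumes "degree q \<le> l" "poly q 0 = 1"
  shows "energy (res_poly l) \<le> energy q"
proof -
  define r where "r = res_poly l"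
  have "poly (q - r) 0 = 0" using assms(2) res_poly_at_0 by (simp add: r_def)
  then obtain h where h: "q - r = pCons 0 h"
    by (metis pCons_cases poly_0_coeff_0 coeff_pCons_0)
  have low: "coeff h j = 0" if "j \<ge> l" for j
  proof -
    have "coeff (q - r) (Suc j) = 0"
      using that assms(1) degree_cg_polys[of l] by (simp add: r_def coeff_eq_0)
    then show ?thesis by (simp add: h)
  qed
  have q: "poly q x = poly r x + x * poly h x" for x
    using arg_cong[OF h, of "\<lambda>p. poly p x"] by simp
  have "energy q = (\<Sum>i\<in>N. m i / \<mu> i * (poly r (\<mu> i))\<^sup>2
      + 2 * (m i * poly r (\<mu> i) * poly h (\<mu> i)) + m i * (\<mu> i * poly h (\<mu> i)) * poly h (\<mu> i))"
    unfolding energy_def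
  proof (intro sum.cong refl)
    fix i assume "i \<in> N"
    then have "\<mu> i \<noteq> 0" using mu_pos by fastforce
    then show "m i / \<mu> i * (poly q (\<mu> i))\<^sup>2 = m i / \<mu> i * (poly r (\<mu> i))\<^sup>2
      + 2 * (m i * poly r (\<mu> i) * poly h (\<mu> i)) + m i * (\<mu> i * poly h (\<mu> i)) * poly h (\<mu> i)"
      by (simp add: q power2_eq_square field_simps)
  qed
  also have "\<dots> = energy r + 2 * ip r h + ip (pCons 0 h) h"
    by (simp add: energy_def ip_def sum.distrib sum_distrib_left)
  also have "ip r h = 0" using res_poly_orthogonal low by (simp add: r_def)
  finally show ?thesis using ip_shift_nonneg[of h] by (simp add: r_def)
qed

lemma res_poly_null_if:
  assumes "degree q \<le> l" "poly q 0 = 1" "null q"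
  shows "null (res_poly l)"
proof -
  have "energy (res_poly l) \<le> 0"
    using res_poly_optimal[OF assms(1,2)] assms(3) by (simp add: energy_zero[symmetric])
  then show ?thesis using energy_nonneg[of "res_poly l"] by (simp add: energy_zero[symmetric])
qed

lemma res_poly_eventually_null: "\<exists>l. null (res_poly l)"
proof -
  define q where "q = (\<Prod>i\<in>N. [:1, - 1 / \<mu> i:])"
  have "degree q \<le> (\<Sum>i\<in>N. degree [:1, - 1 / \<mu> i:])"
    unfolding q_def using degree_prod_sum_le[OF finite_N, of "\<lambda>i. [:1, - 1 / \<mu> i:]"]
    by (simp only: comp_def)
  moreover have "poly q 0 = 1" by (simp add: q_def poly_prod)
  moreover have "poly q (\<mu> i) = 0" if "i \<in> N" for i
    using that mu_pos[OF that] finite_N by (auto simp: q_def poly_prod intro!: bexI[of _ i])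
  then have "null q" by (simp add: null_def)
  ultimately show ?thesis using res_poly_null_if by blast
qed

text \<open>
  Divide a hypothetical bad root out of the residual polynomial and test orthogonality against
  the quotient. Since the removed factor has constant sign at the nodes, the quotient vanishes at
  all of them, and by optimality the residual would have vanished one step earlier.
\<close>

lemma roots_ge_res_poly:
  assumes "0 < x" "\<And>i. i \<in> N \<Longrightarrow> x \<le> \<mu> i"
  shows "roots_ge (res_poly l) x"
proof (induction l)
  case 0
  then show ?case by (simp add: roots_ge_def)
next
  case (Suc l)
  show ?case
  proof (cases "null (res_poly l)")
    case True
    then show ?thesis using Suc res_poly_stops by simp
  next
    case False
    define r where "r = res_poly (Suc l)"
    have r0: "poly r 0 = 1" and degr: "degree r \<le> Suc l"
      using res_poly_at_0 degree_cg_polys by (auto simp: r_def)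
    have no: False if g: "r = q * g" "degree g \<le> l" "poly g 0 = 1"
      and sign: "(\<forall>i\<in>N. 0 < poly q (\<mu> i)) \<or> (\<forall>i\<in>N. poly q (\<mu> i) < 0)" for q g
    proof -
      have "ip r g = 0"
        unfolding r_def using g(2) by (intro res_poly_orthogonal) (auto intro: coeff_eq_0)
      then have s: "(\<Sum>i\<in>N. m i * (poly q (\<mu> i) * (poly g (\<mu> i))\<^sup>2)) = 0"
        by (simp add: ip_def g(1) power2_eq_square mult_ac)
      have "null g" using sign
      proof
        assume "\<forall>i\<in>N. 0 < poly q (\<mu> i)"
        then show ?thesis using s sum_zero_iff_null[of "\<lambda>i. poly q (\<mu> i)" g] by simp
      next
        assume "\<forall>i\<in>N. poly q (\<mu> i) < 0"
        then show ?thesis using s sum_zero_iff_null[of "\<lambda>i. - poly q (\<mu> i)" g]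
          by (simp add: sum_negf)
      qed
      then show False using res_poly_null_if g False by blast
    qed
    show ?thesis
      unfolding roots_ge_def r_def[symmetric]
    proof (intro allI impI)
      fix z :: complex assume z: "poly (map_poly of_real r) z = 0"
      have real: "z \<in> \<real>"
      proof (rule ccontr)
        assume "z \<notin> \<real>"
        then obtain q g where "r = q * g" "\<And>x. 0 < poly q x" "poly g 0 = 1"
          "degree r = degree g + 2"
          using split_nonreal_root[OF r0 z] by metis
        then show False using no[of q g] degr by simp
      qed
      then have v: "poly r (Re z) = 0"
        using z poly_of_real_complex[of r "Re z"]
        by (simp add: complex_is_Real_iff complex_eq_iff)
      then obtain g where g: "r = [:1, -1/Re z:] * g" "poly g 0 = 1" "degree r = Suc (degree g)"
        "Re z \<noteq> 0"
        using split_real_root[OF r0] by metis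
      have "x \<le> Re z"
      proof (rule ccontr)
        assume less: "\<not> x \<le> Re z"
        have "(\<forall>i\<in>N. 0 < poly [:1, -1/Re z:] (\<mu> i)) \<or> (\<forall>i\<in>N. poly [:1, -1/Re z:] (\<mu> i) < 0)"
        proof (cases "Re z < 0")
          case True
          then show ?thesis using mu_pos by (fastforce simp: field_simps)
        next
          case False
          then have "0 < Re z" using g(4) by simp
          moreover have "Re z < \<mu> i" if "i \<in> N" for i using assms(2)[OF that] less by simp
          ultimately show ?thesis by (auto simp: field_simps)
        qed
        then show False using no[OF g(1)] g degr by simp
      qed
      then show "z \<in> \<real> \<and> x \<le> Re z" using real by simp
    qed
  qed
qed

text \<open>
  At a point to the left of all nodes every residual polynomial is nonnegative, hence so are the
  direction polynomials, which are nonnegative combinations of them; and each step subtracts a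
  nonnegative multiple of a direction.
\<close>

lemma res_poly_decreasing:
  assumes "0 < x" "\<And>i. i \<in> N \<Longrightarrow> x \<le> \<mu> i" "j \<le> l"
  shows "poly (res_poly l) x \<le> poly (res_poly j) x"
proof -
  have r: "0 \<le> poly (res_poly l) x" for l
    using roots_ge_bounds roots_ge_res_poly assms(1,2) res_poly_at_0 by blast
  have d: "0 \<le> poly (dir_poly l) x" for l
  proof (induction l)
    case (Suc l)
    then show ?case using r[of "Suc l"] by (simp add: dir_poly_Suc ip_self_nonneg)
  qed simp
  have "poly (res_poly (Suc l)) x \<le> poly (res_poly l) x" for l
    using d[of l] assms(1) by (simp add: res_poly_Suc ip_self_nonneg ip_shift_nonneg)
  then show ?thesis using assms(3) by (rule lift_Suc_antimono_le)
qed

text \<open>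
  A power of the variable can be divided out of a null polynomial, as the nodes are nonzero.
\<close>

lemma null_normalize:
  assumes "null h" "h \<noteq> 0"
  obtains g where "null g" "poly g 0 = 1" "degree g \<le> degree h"
  using assms
proof (induction h arbitrary: thesis)
  case (pCons a h)
  show ?case
  proof (cases "a = 0")
    case True
    have "null h" using pCons.prems(2) True by (simp add: null_pCons_0)
    moreover have "h \<noteq> 0" using pCons.prems True by auto
    ultimately obtain g where "null g" "poly g 0 = 1" "degree g \<le> degree h"
      using pCons.IH by blast
    then show ?thesis using pCons.prems(1)[of g] \<open>h \<noteq> 0\<close> by (simp add: degree_pCons_eq)
  next
    case False
    have "null (smult (1/a) (pCons a h))"
      using pCons.prems(2) by (rule null_smult)
    then show ?thesis
      using pCons.prems(1)[of "smult (1/a) (pCons a h)"] False degree_smult_le by simp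
  qed
qed simp

text \<open>
  Two different minimizers would differ by the variable times a null polynomial of lower degree,
  which after normalization would have made the residual vanish earlier.
\<close>

lemma minimizer_at_termination_unique:
  assumes first: "null (res_poly l)" "\<And>j. j < l \<Longrightarrow> \<not> null (res_poly j)"
    and p: "degree p \<le> l" "poly p 0 = 1" "null p"
  shows "p = res_poly l"
proof (rule ccontr)
  assume "p \<noteq> res_poly l"
  moreover have "poly (p - res_poly l) 0 = 0" using p(2) res_poly_at_0 by simp
  ultimately obtain h where h: "p - res_poly l = pCons 0 h" "h \<noteq> 0"
    by (metis pCons_cases poly_0_coeff_0 coeff_pCons_0 pCons_0_0 right_minus_eq)
  have "null h" using null_diff[OF p(3) first(1)] by (simp add: h(1) null_pCons_0)
  then obtain g where g: "null g" "poly g 0 = 1" "degree g \<le> degree h"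
    using null_normalize h(2) by blast
  have "degree (p - res_poly l) \<le> l" using p(1) degree_cg_polys by (simp add: degree_diff_le)
  then have "Suc (degree h) \<le> l" using h by (simp add: degree_pCons_eq)
  then have "degree g \<le> l - 1" "l - 1 < l" using g(3) by auto
  then show False using first(2) res_poly_null_if g by blast
qed

end

section \<open>The method in an eigenbasis\<close>

lemma orthonormal_coeff:
  fixes s :: "'i \<Rightarrow> real^'n"
  assumes "finite N" "\<And>i. i \<in> N \<Longrightarrow> s j \<bullet> s i = (if i = j then 1 else 0)"
  shows "s j \<bullet> (\<Sum>i\<in>N. c i *\<^sub>R s i) = (if j \<in> N then c j else 0)"
proof -
  have "s j \<bullet> (\<Sum>i\<in>N. c i *\<^sub>R s i) = (\<Sum>i\<in>N. if i = j then c j else 0)"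
    unfolding inner_sum_right using assms(2) by (intro sum.cong refl) auto
  then show ?thesis using assms(1) by simp
qed

lemma orthonormal_inner:
  fixes s :: "'i \<Rightarrow> real^'n"
  assumes "finite N" "\<And>i j. i \<in> N \<Longrightarrow> j \<in> N \<Longrightarrow> s i \<bullet> s j = (if i = j then 1 else 0)"
  shows "(\<Sum>i\<in>N. c i *\<^sub>R s i) \<bullet> (\<Sum>i\<in>N. d i *\<^sub>R s i) = (\<Sum>i\<in>N. c i * d i)"
  unfolding inner_sum_left using assms by (intro sum.cong refl) (simp add: orthonormal_coeff)

lemma matrix_eigen_sum:
  fixes M :: "real^'n^'n"
  assumes "\<And>i. i \<in> N \<Longrightarrow> M *v s i = a i *\<^sub>R s i"
  shows "M *v (\<Sum>i\<in>N. c i *\<^sub>R s i) = (\<Sum>i\<in>N. (a i * c i) *\<^sub>R s i)"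
  using assms
  by (simp add: linear_sum[OF matrix_vector_mul_linear] matrix_vector_mult_scaleR mult.commute)

text \<open>
  When preconditioner and matrix share orthonormal eigenvectors, the scalars of the method are
  inner products with respect to the measure that puts mass \<open>f i * (c i)\<^sup>2\<close> on the eigenvalue
  \<open>f i * a i\<close> of the preconditioned matrix. The index set only has to
  support the initial residual, so that a singular matrix is covered as well.
\<close>

lemma pcg_residual:
  fixes F M :: "real^'n^'n" and b x0 :: "real^'n" and s :: "'i \<Rightarrow> real^'n"
  assumes fin: "finite N"
    and orth: "\<And>i j. i \<in> N \<Longrightarrow> j \<in> N \<Longrightarrow> s i \<bullet> s j = (if i = j then 1 else 0)"
    and pos: "\<And>i. i \<in> N \<Longrightarrow> 0 < f i" "\<And>i. i \<in> N \<Longrightarrow> 0 < a i"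
    and F: "\<And>i. i \<in> N \<Longrightarrow> F *v s i = f i *\<^sub>R s i"
    and M: "\<And>i. i \<in> N \<Longrightarrow> M *v s i = a i *\<^sub>R s i"
    and r0: "b - M *v x0 = (\<Sum>i\<in>N. c i *\<^sub>R s i)"
  defines "m \<equiv> \<lambda>i. f i * (c i)\<^sup>2" and "\<mu> \<equiv> \<lambda>i. f i * a i"
  shows "b - M *v pcg F M b x0 l =
    (\<Sum>i\<in>N. (c i * poly (discrete_measure.res_poly N m \<mu> l) (\<mu> i)) *\<^sub>R s i)"
proof -
  interpret discrete_measure N m \<mu>
    using fin pos by unfold_locales (auto simp: m_def \<mu>_def less_imp_le)
  have m: "m i = f i * (c i)\<^sup>2" and mu: "\<mu> i = f i * a i" for i
    by (simp_all add: m_def \<mu>_def)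
  have comb: "(\<Sum>i\<in>N. u i *\<^sub>R s i) \<bullet> (\<Sum>i\<in>N. w i *\<^sub>R s i) = (\<Sum>i\<in>N. u i * w i)" for u w
    using fin orth by (rule orthonormal_inner)
  define r where "r l = (\<Sum>i\<in>N. (c i * poly (res_poly l) (\<mu> i)) *\<^sub>R s i)" for l
  define d where "d l = (\<Sum>i\<in>N. (f i * (c i * poly (dir_poly l) (\<mu> i))) *\<^sub>R s i)" for l
  have Fr: "F *v r l = (\<Sum>i\<in>N. (f i * (c i * poly (res_poly l) (\<mu> i))) *\<^sub>R s i)" for l
    unfolding r_def by (rule matrix_eigen_sum) (rule F)
  have Md: "M *v d l = (\<Sum>i\<in>N. (a i * (f i * (c i * poly (dir_poly l) (\<mu> i)))) *\<^sub>R s i)" for l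
    unfolding d_def by (rule matrix_eigen_sum) (rule M)
  have rho: "r l \<bullet> (F *v r l) = ip (res_poly l) (res_poly l)" for l
    unfolding Fr unfolding r_def comb ip_def
    by (intro sum.cong refl) (simp add: m power2_eq_square)
  have qp: "(M *v d l) \<bullet> d l = ip (pCons 0 (dir_poly l)) (dir_poly l)" for l
    unfolding Md unfolding d_def comb ip_def
    by (intro sum.cong refl) (simp add: m mu power2_eq_square)
  have r_Suc: "r (Suc l) = r l - (ip (res_poly l) (res_poly l) /
      ip (pCons 0 (dir_poly l)) (dir_poly l)) *\<^sub>R (M *v d l)" for l
    unfolding Md unfolding r_def res_poly_Suc scaleR_sum_right sum_subtractf[symmetric]
    by (intro sum.cong refl) (simp add: mu algebra_simps)
  have d_Suc: "d (Suc l) = F *v r (Suc l) + (ip (res_poly (Suc l)) (res_poly (Suc l)) /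
      ip (res_poly l) (res_poly l)) *\<^sub>R d l" for l
    unfolding Fr unfolding d_def dir_poly_Suc scaleR_sum_right sum.distrib[symmetric]
    by (intro sum.cong refl) (simp add: algebra_simps)
  have "\<exists>x. pcg_state F M b x0 l = (x, r l, d l) \<and> b - M *v x = r l"
  proof (induction l)
    case 0
    have "r 0 = b - M *v x0" by (simp add: r_def r0)
    moreover have "d 0 = F *v r 0" unfolding Fr by (simp add: d_def)
    ultimately show ?case by simp
  next
    case (Suc l)
    then obtain x where x: "pcg_state F M b x0 l = (x, r l, d l)" "b - M *v x = r l" by blast
    define \<alpha> where "\<alpha> = ip (res_poly l) (res_poly l) / ip (pCons 0 (dir_poly l)) (dir_poly l)"
    have "pcg_state F M b x0 (Suc l) = (x + \<alpha> *\<^sub>R d l, r (Suc l), d (Suc l))"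
      by (simp add: x(1) Let_def rho qp r_Suc[symmetric] d_Suc[symmetric] \<alpha>_def)
    moreover have "b - M *v (x + \<alpha> *\<^sub>R d l) = r (Suc l)"
      using x(2) by (simp add: r_Suc \<alpha>_def matrix_vector_right_distrib
          matrix_vector_mult_scaleR diff_diff_eq[symmetric])
    ultimately show ?case by blast
  qed
  then obtain x where "pcg_state F M b x0 l = (x, r l, d l)" "b - M *v x = r l" by blast
  then show ?thesis by (simp add: pcg_def r_def)
qed

lemma outer_mult: "outer v *v x = (v \<bullet> x) *\<^sub>R v"
  by (simp add: vec_eq_iff outer_def matrix_vector_mult_def inner_vec_def sum_distrib_left mult_ac)

lemma sum_scaleR_matrix_vector_mult:
  fixes M :: "'i \<Rightarrow> real^'n^'n"
  shows "(\<Sum>i\<in>N. c i *\<^sub>R M i) *v x = (\<Sum>i\<in>N. c i *\<^sub>R (M i *v x))"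
proof (induction N rule: infinite_finite_induct)
  case (insert i N)
  then show ?case by (simp add: matrix_vector_mult_add_rdistrib scaleR_matrix_vector_assoc)
qed simp_all

lemma defl_proj_mult: "defl_proj s I *v x = x - (\<Sum>i\<in>I. (s i \<bullet> x) *\<^sub>R s i)"
  using sum_scaleR_matrix_vector_mult[of "\<lambda>_. 1" "\<lambda>i. outer (s i)" I x]
  by (simp add: defl_proj_def matrix_vector_mult_diff_rdistrib outer_mult)

lemma defl_precond_mult:
  "defl_precond s lam I \<theta> *v x = x + (\<Sum>i\<in>I. ((\<theta> / lam i - 1) * (s i \<bullet> x)) *\<^sub>R s i)"
  by (simp add: defl_precond_def matrix_vector_mult_add_rdistrib sum_scaleR_matrix_vector_mult
      outer_mult)

lemma spectral_orthonormal:
  fixes A :: "real^'n^'n"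
  assumes "spectral_decomposition A s lam" "i \<in> {1..CARD('n)}" "j \<in> {1..CARD('n)}"
  shows "s i \<bullet> s j = (if i = j then 1 else 0)"
  using assms unfolding spectral_decomposition_def by blast

lemma spectral_mult:
  fixes A :: "real^'n^'n"
  assumes "spectral_decomposition A s lam"
  shows "A *v x = (\<Sum>i=1..CARD('n). (lam i * (s i \<bullet> x)) *\<^sub>R s i)"
proof -
  have A: "A = (\<Sum>i=1..CARD('n). lam i *\<^sub>R outer (s i))"
    using assms unfolding spectral_decomposition_def by blast
  show ?thesis by (subst A) (simp add: sum_scaleR_matrix_vector_mult outer_mult)
qed

lemma inner_orthonormal_sum:
  fixes A :: "real^'n^'n"
  assumes "spectral_decomposition A s lam" "N \<subseteq> {1..CARD('n)}" "j \<in> {1..CARD('n)}"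
  shows "s j \<bullet> (\<Sum>i\<in>N. c i *\<^sub>R s i) = (if j \<in> N then c j else 0)"
  using finite_subset[OF assms(2)] spectral_orthonormal[OF assms(1,3)] assms(2)
  by (intro orthonormal_coeff) auto

lemma spectral_inner_mult:
  fixes A :: "real^'n^'n"
  assumes "spectral_decomposition A s lam" "j \<in> {1..CARD('n)}"
  shows "s j \<bullet> (A *v x) = lam j * (s j \<bullet> x)"
  unfolding spectral_mult[OF assms(1)] using inner_orthonormal_sum[OF assms(1) order_refl assms(2)] assms(2)
  by simp

lemma spectral_eigenvector:
  fixes A :: "real^'n^'n"
  assumes "spectral_decomposition A s lam" "j \<in> {1..CARD('n)}"
  shows "A *v s j = lam j *\<^sub>R s j"
proof -
  have "A *v s j = (\<Sum>i=1..CARD('n). if i = j then lam j *\<^sub>R s j else 0)"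
    unfolding spectral_mult[OF assms(1)] using spectral_orthonormal[OF assms(1) _ assms(2)]
    by (intro sum.cong refl) auto
  then show ?thesis using assms(2) by simp
qed

lemma spectral_bounds:
  fixes A :: "real^'n^'n"
  assumes "spectral_decomposition A s lam" "i \<in> {1..CARD('n)}"
  shows "lam CARD('n) \<le> lam i" "0 < lam i"
proof -
  show "lam CARD('n) \<le> lam i"
    using assms unfolding spectral_decomposition_def by (simp add: Suc_le_eq)
  then show "0 < lam i" using assms(1) unfolding spectral_decomposition_def by linarith
qed

lemma energy_norm_spectral:
  fixes A :: "real^'n^'n"
  assumes sd: "spectral_decomposition A s lam" and N: "N \<subseteq> {1..CARD('n)}"
    and Ae: "A *v e = (\<Sum>i\<in>N. c i *\<^sub>R s i)"
  shows "(energy_norm A e)\<^sup>2 = (\<Sum>i\<in>N. (c i)\<^sup>2 / lam i)"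
proof -
  have "c i * (s i \<bullet> e) = (c i)\<^sup>2 / lam i" if "i \<in> N" for i
  proof -
    have i: "i \<in> {1..CARD('n)}" using that N by blast
    then have "lam i * (s i \<bullet> e) = c i"
      using spectral_inner_mult[OF sd i, of e] inner_orthonormal_sum[OF sd N i] that Ae by simp
    then have "s i \<bullet> e = c i / lam i"
      using spectral_bounds(2)[OF sd i] by (simp add: field_simps)
    then show ?thesis by (simp add: power2_eq_square)
  qed
  then have "e \<bullet> (A *v e) = (\<Sum>i\<in>N. (c i)\<^sup>2 / lam i)"
    unfolding Ae inner_sum_right by (simp add: inner_commute)
  moreover have "0 \<le> (\<Sum>i\<in>N. (c i)\<^sup>2 / lam i)"
    using spectral_bounds(2)[OF sd] N
    by (intro sum_nonneg divide_nonneg_pos) auto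
  ultimately show ?thesis by (simp add: energy_norm_def)
qed

lemma pos_def_solution:
  fixes A :: "real^'n^'n"
  assumes "pos_def A"
  shows "A *v (matrix_inv A *v b) = b"
proof -
  have "\<forall>x. A *v x = 0 \<longrightarrow> x = 0"
    using assms unfolding pos_def_def by (metis inner_zero_right less_irrefl)
  then have "invertible A"
    by (simp add: invertible_left_inverse matrix_left_invertible_ker)
  then have "A ** matrix_inv A = mat 1"
    unfolding matrix_inv_def invertible_def by (rule someI2_ex) simp
  then show ?thesis by (simp add: matrix_vector_mul_assoc)
qed

section \<open>Comparison of the preconditioned and the deflated method\<close>

theorem theorem4p7:
  fixes A :: "real^'n^'n" and b x0 r0 xstar :: "real^'n"
    and s :: "nat \<Rightarrow> real^'n" and lam eta :: "nat \<Rightarrow> real"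
    and n k :: nat and I K :: "nat set" and \<epsilon> :: real
    and F :: "real^'n^'n" and close_at :: "nat \<Rightarrow> bool"
  assumes n_def: "n = CARD('n)"
    and A_spd: "pos_def A"
    and A_spec: "spectral_decomposition A s lam"
    and k_bounds: "1 < k" "k < n"
    and I_selected: "selected_index_set lam n k I"
    and K_def: "K = {1..n} - I"
    and xstar_def: "xstar = matrix_inv A *v b"
    and r0_def: "r0 = b - A *v x0"
    and eta_def: "eta = (\<lambda>i. s i \<bullet> r0)"
    and F_def: "F = defl_precond s lam I (lam n)"
    and eps_nonneg: "0 \<le> \<epsilon>"
    and eta_n: "eta n \<noteq> 0"
    and close_at_def: "close_at = (\<lambda>l0. defl_cg_reaches A b x0 s I l0 \<and>
          (\<exists>p v. defl_argmin lam eta K l0 = {p} \<and> is_smallest_root p v \<and> \<bar>lam n - v\<bar> \<le> \<epsilon>))"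
  shows "(n \<in> K \<longrightarrow> (\<exists>l0. close_at l0)) \<and>
    (\<forall>l0. close_at l0 \<longrightarrow>
      (\<forall>l\<ge>1. pcg F A b x0 l \<noteq> xstar \<longrightarrow>
        (l < l0 \<longrightarrow>
           (energy_norm A (xstar - pcg F A b x0 l))\<^sup>2
             \<le> (energy_norm A (xstar - defl_cg A b x0 s lam I l))\<^sup>2
               + (\<Sum>i\<in>I. (eta i)\<^sup>2 / lam i)) \<and>
        (l0 \<le> l \<longrightarrow>
           (energy_norm A (xstar - pcg F A b x0 l))\<^sup>2
             \<le> (energy_norm A (xstar - defl_cg A b x0 s lam I l))\<^sup>2
               + \<epsilon>\<^sup>2 / (lam n)\<^sup>2 * (\<Sum>i\<in>I. (eta i)\<^sup>2 / lam i))))"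
proof -
  note sd = A_spec
  note coeff = spectral_orthonormal[OF sd, folded n_def] inner_orthonormal_sum[OF sd, folded n_def]
  note lam = spectral_bounds[OF sd, folded n_def]
  note A_eig = spectral_eigenvector[OF sd, folded n_def]
  note A_inner = spectral_inner_mult[OF sd, folded n_def]
  note A_mult = spectral_mult[OF sd, folded n_def]
  have n_mem: "n \<in> {1..n}" using k_bounds by simp
  have lam_n: "0 < lam n" using lam(2) n_mem by blast
  have I: "I \<subseteq> {1..n}"
    using I_selected by (simp add: selected_index_set_def is_arg_min_def)
  have fin_I: "finite I" using I by (rule finite_subset) simp
  have K: "K \<subseteq> {1..n}" "finite K" "{1..n} - I = K" by (auto simp: K_def)
  have split_sum: "sum g {1..n} = sum g K + sum g I" for g :: "nat \<Rightarrow> 'b::ab_group_add"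
    using sum.subset_diff[OF I finite_atLeastAtMost, of g] unfolding K(3) .
  have Axs: "A *v xstar = b" unfolding xstar_def by (rule pos_def_solution[OF A_spd])
  have r0_expand: "r0 = (\<Sum>i\<in>{1..n}. eta i *\<^sub>R s i)"
  proof -
    have r0: "r0 = A *v (xstar - x0)"
      by (simp add: r0_def Axs[symmetric] matrix_vector_mult_diff_distrib)
    then have "eta i = lam i * (s i \<bullet> (xstar - x0))" if "i \<in> {1..n}" for i
      using A_inner[OF that] by (simp add: eta_def)
    then show ?thesis unfolding r0 A_mult by (intro sum.cong refl) simp
  qed
  \<comment> \<open>preconditioning moves every eigenvalue with index in \<open>I\<close> to \<open>lam n\<close>\<close>
  define f where "f i = (if i \<in> I then lam n / lam i else 1)" for i
  define m where "m i = f i * (eta i)\<^sup>2" for i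
  define \<mu> where "\<mu> i = f i * lam i" for i
  have f_pos: "0 < f i" if "i \<in> {1..n}" for i
    using lam(2)[OF that] lam_n by (simp add: f_def)
  interpret P: discrete_measure "{1..n}" m \<mu>
    using lam(2) f_pos by unfold_locales (simp_all add: m_def \<mu>_def less_imp_le)
  interpret D: discrete_measure K "\<lambda>i. (eta i)\<^sup>2" lam
    using lam(2) K by unfold_locales auto
  have F_eig: "F *v s i = f i *\<^sub>R s i" if i: "i \<in> {1..n}" for i
  proof -
    have "F *v s i = s i + (\<Sum>j\<in>I. (if j = i then (lam n / lam i - 1) *\<^sub>R s i else 0))"
      unfolding F_def defl_precond_mult using coeff(1)[OF _ i] I
      by (intro arg_cong2[of _ _ _ _ "(+)"] sum.cong refl) auto
    then show ?thesis using fin_I by (simp add: f_def algebra_simps)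
  qed
  have energy_P: "(energy_norm A (xstar - pcg F A b x0 l))\<^sup>2 = P.energy (P.res_poly l)" for l
  proof -
    have "b - A *v pcg F A b x0 l = (\<Sum>i\<in>{1..n}. (eta i * poly (P.res_poly l) (\<mu> i)) *\<^sub>R s i)"
      unfolding m_def[abs_def] \<mu>_def[abs_def]
      by (rule pcg_residual) (use coeff(1) f_pos lam(2) F_eig A_eig r0_expand r0_def in auto)
    then have "A *v (xstar - pcg F A b x0 l)
        = (\<Sum>i\<in>{1..n}. (eta i * poly (P.res_poly l) (\<mu> i)) *\<^sub>R s i)"
      by (simp add: Axs matrix_vector_mult_diff_distrib)
    then have "(energy_norm A (xstar - pcg F A b x0 l))\<^sup>2
        = (\<Sum>i\<in>{1..n}. (eta i * poly (P.res_poly l) (\<mu> i))\<^sup>2 / lam i)"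
      by (intro energy_norm_spectral[OF sd]) (simp_all add: n_def)
    also have "\<dots> = P.energy (P.res_poly l)"
      unfolding P.energy_def
    proof (intro sum.cong refl)
      fix i assume "i \<in> {1..n}"
      then show "(eta i * poly (P.res_poly l) (\<mu> i))\<^sup>2 / lam i
          = m i / \<mu> i * (poly (P.res_poly l) (\<mu> i))\<^sup>2"
        using f_pos[of i] lam(2)[of i] by (simp add: m_def \<mu>_def power_mult_distrib)
    qed
    finally show ?thesis .
  qed
  have energy_split: "P.energy q = D.energy q
      + (poly q (lam n))\<^sup>2 * (\<Sum>i\<in>I. (eta i)\<^sup>2 / lam i)" for q
  proof -
    have "(\<Sum>i\<in>K. m i / \<mu> i * (poly q (\<mu> i))\<^sup>2) = D.energy q"
      unfolding D.energy_def using K(3)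
      by (intro sum.cong refl) (auto simp: m_def \<mu>_def f_def)
    moreover have "(\<Sum>i\<in>I. m i / \<mu> i * (poly q (\<mu> i))\<^sup>2)
        = (poly q (lam n))\<^sup>2 * (\<Sum>i\<in>I. (eta i)\<^sup>2 / lam i)"
      unfolding sum_distrib_left
    proof (intro sum.cong refl)
      fix i assume i: "i \<in> I"
      then have "0 < lam i" using I lam(2) by blast
      then show "m i / \<mu> i * (poly q (\<mu> i))\<^sup>2 = (poly q (lam n))\<^sup>2 * ((eta i)\<^sup>2 / lam i)"
        using i lam_n by (simp add: m_def \<mu>_def f_def)
    qed
    ultimately show ?thesis unfolding P.energy_def split_sum by simp
  qed
  define Q where "Q = defl_proj s I"
  have Q_expand: "Q *v (\<Sum>i\<in>{1..n}. c i *\<^sub>R s i) = (\<Sum>i\<in>K. c i *\<^sub>R s i)" for c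
  proof -
    have "(s j \<bullet> (\<Sum>i\<in>{1..n}. c i *\<^sub>R s i)) = c j" if "j \<in> I" for j
      using coeff(2)[OF order_refl] I that by auto
    then have "(\<Sum>j\<in>I. (s j \<bullet> (\<Sum>i\<in>{1..n}. c i *\<^sub>R s i)) *\<^sub>R s j) = (\<Sum>j\<in>I. c j *\<^sub>R s j)"
      by simp
    then show ?thesis unfolding Q_def defl_proj_mult split_sum by simp
  qed
  have QA_commute: "A *v (Q *v z) = Q *v (A *v z)" for z
  proof -
    have "A *v (\<Sum>i\<in>I. (s i \<bullet> z) *\<^sub>R s i) = (\<Sum>i\<in>I. (s i \<bullet> (A *v z)) *\<^sub>R s i)"
      using A_inner A_eig I by (subst matrix_eigen_sum[of I A s lam]) (auto intro!: sum.cong)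
    then show ?thesis by (simp add: Q_def defl_proj_mult matrix_vector_mult_diff_distrib)
  qed
  have Q_eig: "Q *v s i = s i" if i: "i \<in> K" for i
  proof -
    have "s j \<bullet> s i = 0" if "j \<in> I" for j using coeff(1)[of j i] that i I K by auto
    then show ?thesis by (simp add: Q_def defl_proj_mult)
  qed
  have res_D: "Q *v b - (Q ** A) *v defl_inner A b x0 s I l
      = (\<Sum>i\<in>K. (eta i * poly (D.res_poly l) (lam i)) *\<^sub>R s i)" for l
  proof -
    have Q0: "Q *v b - (Q ** A) *v x0 = (\<Sum>i\<in>K. eta i *\<^sub>R s i)"
      using Q_expand[of eta] unfolding r0_expand[symmetric] r0_def
      by (simp add: matrix_vector_mult_diff_distrib matrix_vector_mul_assoc[symmetric])
    have "(Q ** A) *v s i = lam i *\<^sub>R s i" if "i \<in> K" for i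
      using that K A_eig Q_eig
      by (auto simp: matrix_vector_mul_assoc[symmetric] matrix_vector_mult_scaleR)
    then have "Q *v b - (Q ** A) *v pcg (mat 1) (Q ** A) (Q *v b) x0 l =
      (\<Sum>i\<in>K. (eta i * poly (discrete_measure.res_poly K (\<lambda>i. 1 * (eta i)\<^sup>2) (\<lambda>i. 1 * lam i) l)
        (1 * lam i)) *\<^sub>R s i)"
      by (intro pcg_residual) (use coeff(1) lam(2) K Q0 in auto)
    then show ?thesis by (simp add: defl_inner_def cg_def Q_def)
  qed
  have energy_D: "(energy_norm A (xstar - defl_cg A b x0 s lam I l))\<^sup>2 = D.energy (D.res_poly l)" for l
  proof -
    have "A *v (\<Sum>i\<in>I. (1 / lam i) *\<^sub>R (outer (s i) *v b)) = (\<Sum>i\<in>I. (s i \<bullet> b) *\<^sub>R s i)"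
    proof -
      have "(\<Sum>i\<in>I. (1 / lam i) *\<^sub>R (outer (s i) *v b)) = (\<Sum>i\<in>I. (s i \<bullet> b / lam i) *\<^sub>R s i)"
        by (simp add: outer_mult)
      moreover have "lam i * (s i \<bullet> b / lam i) = s i \<bullet> b" if "i \<in> I" for i
        using that I lam(2)[of i] by auto
      ultimately show ?thesis
        using A_eig I by (simp add: matrix_eigen_sum[of I A s lam] subset_iff)
    qed
    then have "A *v (xstar - defl_cg A b x0 s lam I l)
        = Q *v b - (Q ** A) *v defl_inner A b x0 s I l"
      by (simp add: defl_cg_def Q_def[symmetric] QA_commute matrix_vector_mul_assoc[symmetric]
          matrix_vector_mult_diff_distrib matrix_vector_right_distrib Axs)
        (simp add: Q_def defl_proj_mult)
    then have "(energy_norm A (xstar - defl_cg A b x0 s lam I l))\<^sup>2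
        = (\<Sum>i\<in>K. (eta i * poly (D.res_poly l) (lam i))\<^sup>2 / lam i)"
      using K(1) res_D by (intro energy_norm_spectral[OF sd]) (simp_all add: n_def)
    also have "\<dots> = D.energy (D.res_poly l)"
      by (simp add: D.energy_def power_mult_distrib)
    finally show ?thesis .
  qed
  \<comment> \<open>the deflated residual polynomial competes in the minimum attained by the other method\<close>
  have bound: "(energy_norm A (xstar - pcg F A b x0 l))\<^sup>2
      \<le> (energy_norm A (xstar - defl_cg A b x0 s lam I l))\<^sup>2
        + t\<^sup>2 * (\<Sum>i\<in>I. (eta i)\<^sup>2 / lam i)"
    if "0 \<le> poly (D.res_poly l) (lam n)" "poly (D.res_poly l) (lam n) \<le> t" for l t
  proof -
    have "P.energy (P.res_poly l) \<le> P.energy (D.res_poly l)"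
      using D.degree_cg_polys D.res_poly_at_0 by (intro P.res_poly_optimal) auto
    moreover have "0 \<le> (\<Sum>i\<in>I. (eta i)\<^sup>2 / lam i)"
      using I lam(2) by (intro sum_nonneg divide_nonneg_pos) auto
    then have "(poly (D.res_poly l) (lam n))\<^sup>2 * (\<Sum>i\<in>I. (eta i)\<^sup>2 / lam i)
        \<le> t\<^sup>2 * (\<Sum>i\<in>I. (eta i)\<^sup>2 / lam i)"
      using that by (intro mult_right_mono power_mono)
    ultimately show ?thesis unfolding energy_P energy_D energy_split by linarith
  qed
  have left: "lam n \<le> lam i" if "i \<in> K" for i using that K(1) lam(1) by blast
  have roots: "roots_ge (D.res_poly l) (lam n)" for l
    using D.roots_ge_res_poly lam_n left by blast
  have range: "0 \<le> poly (D.res_poly l) (lam n)" "poly (D.res_poly l) (lam n) \<le> 1" for l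
    using roots_ge_bounds[OF roots D.res_poly_at_0 lam_n] by auto
  have argmin_iff: "p \<in> defl_argmin lam eta K l \<longleftrightarrow> degree p \<le> l \<and> poly p 0 = 1 \<and>
      (\<forall>q. degree q \<le> l \<and> poly q 0 = 1 \<longrightarrow> D.energy p \<le> D.energy q)" for p l
    unfolding defl_argmin_def is_arg_min_def polys_one_def D.energy_def[symmetric] mem_Collect_eq
      not_less[symmetric] by blast
  have res_argmin: "D.res_poly l \<in> defl_argmin lam eta K l" for l
    unfolding argmin_iff using D.res_poly_optimal D.degree_cg_polys D.res_poly_at_0 by blast
  \<comment> \<open>at the step where deflated CG terminates, its polynomial vanishes at \<open>lam n\<close>,
    which carries weight in the measure\<close>
  have "\<exists>l0. close_at l0" if nK: "n \<in> K"
  proof -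
    define l0 where "l0 = (LEAST l. D.null (D.res_poly l))"
    have null: "D.null (D.res_poly l0)"
      unfolding l0_def using D.res_poly_eventually_null by (rule LeastI_ex)
    have first: "\<not> D.null (D.res_poly j)" if "j < l0" for j
      using that not_less_Least unfolding l0_def by blast
    have "defl_cg_reaches A b x0 s I l0"
      unfolding defl_cg_reaches_def
    proof (intro allI impI notI)
      fix j assume j: "j < l0"
        and eq: "(defl_proj s I ** A) *v defl_inner A b x0 s I j = defl_proj s I *v b"
      have zero: "(\<Sum>i\<in>K. (eta i * poly (D.res_poly j) (lam i)) *\<^sub>R s i) = 0"
        using res_D[of j] eq by (simp add: Q_def)
      have "eta i * poly (D.res_poly j) (lam i) = 0" if "i \<in> K" for i
        using coeff(2)[OF K(1), of i "\<lambda>i. eta i * poly (D.res_poly j) (lam i)"] that K(1) zero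
        by auto
      then show False using first[OF j] by (auto simp: D.null_def)
    qed
    moreover have "defl_argmin lam eta K l0 = {D.res_poly l0}"
    proof -
      have "p = D.res_poly l0" if "p \<in> defl_argmin lam eta K l0" for p
      proof -
        have p: "degree p \<le> l0" "poly p 0 = 1" "D.energy p \<le> D.energy (D.res_poly l0)"
          using that D.degree_cg_polys[of l0] D.res_poly_at_0[of l0] unfolding argmin_iff by blast+
        then have "D.energy p = 0"
          using null D.energy_nonneg[of p] by (simp add: D.energy_zero[symmetric])
        then show ?thesis
          using D.minimizer_at_termination_unique[OF null first p(1,2)] by (simp add: D.energy_zero)
      qed
      then show ?thesis using res_argmin by blast
    qed
    moreover have "is_smallest_root (D.res_poly l0) (lam n)"
    proof -
      have "poly (D.res_poly l0) (lam n) = 0" using null nK eta_n by (auto simp: D.null_def)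
      then show ?thesis
        using roots_ge_real_root[OF roots] by (simp add: is_smallest_root_def)
    qed
    ultimately have "close_at l0" using eps_nonneg unfolding close_at_def by auto
    then show ?thesis by blast
  qed
  moreover have "(energy_norm A (xstar - pcg F A b x0 l))\<^sup>2
      \<le> (energy_norm A (xstar - defl_cg A b x0 s lam I l))\<^sup>2 + (\<Sum>i\<in>I. (eta i)\<^sup>2 / lam i)" for l
    using bound[OF range] by simp
  moreover have "(energy_norm A (xstar - pcg F A b x0 l))\<^sup>2
      \<le> (energy_norm A (xstar - defl_cg A b x0 s lam I l))\<^sup>2
        + \<epsilon>\<^sup>2 / (lam n)\<^sup>2 * (\<Sum>i\<in>I. (eta i)\<^sup>2 / lam i)"
    if close: "close_at l0" and l: "l0 \<le> l" for l0 l
  proof -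
    obtain p v where p: "defl_argmin lam eta K l0 = {p}" "is_smallest_root p v" "\<bar>lam n - v\<bar> \<le> \<epsilon>"
      using close unfolding close_at_def by blast
    have root: "poly (D.res_poly l0) v = 0"
      using p(1,2) res_argmin[of l0] by (simp add: is_smallest_root_def)
    then have v: "lam n \<le> v" using roots_ge_real_root[OF roots] by blast
    have "poly (D.res_poly l) (lam n) \<le> poly (D.res_poly l0) (lam n)"
      using lam_n left l by (rule D.res_poly_decreasing)
    also have "\<dots> \<le> 1 - lam n / v"
      using roots_ge_root_bound[OF roots D.res_poly_at_0 lam_n root] .
    also have "\<dots> = (v - lam n) / v" using v lam_n by (simp add: field_simps)
    also have "\<dots> \<le> \<epsilon> / lam n" using v lam_n p(3) by (intro frac_le) auto
    finally have "poly (D.res_poly l) (lam n) \<le> \<epsilon> / lam n" .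
    from bound[OF range(1) this] show ?thesis by (simp add: power_divide)
  qed
  ultimately show ?thesis by blast
qed

end
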